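(* Let $I=\{(v,w):0\le v,w\le 2\}$ be the maximal order index set for $k=2$ (9 modes), and for real $c>-2/45$ put $\theta=5/(45c+2)$. Let $\tilde{\mathbf C}_{tp}(c)$ be the tensor-product correction matrix and $\tilde{\mathbf C}_{DG}$ the DG correction matrix (both $9\times 12$, defined in the context). Suppose $\tilde{\mathbf Q}$ is a real symmetric $9\times9$ matrix such that $\tilde{\mathbf Q}\tilde{\mathbf D}_x$ and $\tilde{\mathbf Q}\tilde{\mathbf D}_y$ are antisymmetric, $\tilde{\mathbf M}+\tilde{\mathbf Q}$ is positive definite, and $\tilde{\mathbf T}\tilde{\mathbf Q}=\tilde{\mathbf Q}\tilde{\mathbf T}$ for every rotation $\tilde{\mathbf T}$ of the reference square by a multiple of $\pi/2$. Then $$\tilde{\mathbf Q}\,\tilde{\mathbf C}_{tp}(c)=-\tilde{\mathbf M}\left(\tilde{\mathbf C}_{tp}(c)-\tilde{\mathbf C}_{DG}\right)$$ holds if and only if $c=0$ and $\tilde{\mathbf Q}=0$.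
   Context: The reference element is $\hat K=[-1,1]^2$, and $\psi_n$ is the Legendre polynomial of degree $n$ normalised by $\psi_n(1)=1$. The approximation space is spanned by the modes $\phi_{(v,w)}(x,y)=\psi_v(x)\psi_w(y)$, $(v,w)\in I$, ordered by $i=3w+v+1$. A vector of coefficients $\tilde{\mathbf u}$ represents $\sum_{a\in I}\tilde u_a\phi_a$. The modal mass matrix is $\tilde M_{a,b}=\int_{\hat K}\phi_a\phi_b\,\mathrm{d}x\,\mathrm{d}y$. The matrices $\tilde{\mathbf D}_x,\tilde{\mathbf D}_y$ represent $\partial/\partial x,\partial/\partial y$ on coefficient vectors. The rotation matrices $\tilde{\mathbf T}$ represent, on coefficient vectors, the maps $p(x,y)\mapsto p(R(x,y))$ with $R$ the rotation by $\pi/2$, $\pi$ or $3\pi/2$ about the origin. The 12 columns of a correction matrix correspond to (face, face mode) pairs: columns 1–3, 4–6, 7–9, 10–12 are the bottom ($y=-1$), right ($x=1$), top ($y=1$) and left ($x=-1$) faces, each with face modes $\psi_0(s),\psi_1(s),\psi_2(s)$, where the face parameter is $s=x$, $s=y$, $s=-x$, $s=-y$ respectively. The DG correction matrix $\tilde{\mathbf C}_{DG}=\tilde{\mathbf M}^{-1}\tilde{\mathbf L}_\partial^T\tilde{\mathbf W}_\partial$ has as its column for face $f$ and mode $m$ the coefficient vector of the polynomial $p$ in the space with $\int_{\hat K}p\,\phi_a\,\mathrm{d}x\,\mathrm{d}y=\int_f\psi_m(s)\,\phi_a\,\mathrm{d}s$ for all $a\in I$. The tensor-product correction matrix, built from the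 one-parameter family (parameter $c$) of energy stable one-dimensional flux reconstruction correction functions, is $$\tilde{\mathbf C}_{tp}(c)=\begin{bmatrix} \frac12&0&0&\frac12&0&0&\frac12&0&0&\frac12&0&0\\ 0&\frac12&0&\frac32&0&0&0&-\frac12&0&-\frac32&0&0\\ 0&0&\frac12&\theta&0&0&0&0&\frac12&\theta&0&0\\ -\frac32&0&0&0&\frac12&0&\frac32&0&0&0&-\frac12&0\\ 0&-\frac32&0&0&\frac32&0&0&-\frac32&0&0&\frac32&0\\ 0&0&-\frac32&0&\theta&0&0&0&\frac32&0&-\theta&0\\ \theta&0&0&0&0&\frac12&\theta&0&0&0&0&\frac12\\ 0&\theta&0&0&0&\frac32&0&-\theta&0&0&0&-\frac32\\ 0&0&\theta&0&0&\theta&0&0&\theta&0&0&\theta \end{bmatrix}.$$ *)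

theory Defs
  imports "HOL-Analysis.Analysis" "Jordan_Normal_Form.Matrix"
begin

unbundle no vec_syntax and no inner_syntax

text \<open>Legendre polynomials by Bonnet's recursion, which yields the normalisation
  \<open>legendre n 1 = 1\<close> (lemma \<open>legendre_1\<close> below).\<close>

fun legendre :: "nat \<Rightarrow> real \<Rightarrow> real" where
  "legendre 0 x = 1"
| "legendre (Suc 0) x = x"
| "legendre (Suc (Suc n)) x =
     (real (2 * n + 3) * x * legendre (Suc n) x - real (n + 1) * legendre n x) / real (n + 2)"

definition ref_square :: "(real \<times> real) set" where
  "ref_square = {-1..1} \<times> {-1..1}"

text \<open>Matrix and vector indices are 0-based: the mode \<open>(v, w)\<close> with \<open>v, w \<le> 2\<close> has index
  \<open>3 * w + v\<close>, and column \<open>3 * f + m\<close> of a correction matrix belongs to face number \<open>f\<close>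
  (bottom, right, top, left) and face mode \<open>m \<le> 2\<close>.\<close>

definition phi :: "nat \<Rightarrow> real \<times> real \<Rightarrow> real" where
  "phi i = (\<lambda>(x, y). legendre (i mod 3) x * legendre (i div 3) y)"

definition expand :: "real vec \<Rightarrow> real \<times> real \<Rightarrow> real" where
  "expand u = (\<lambda>z. \<Sum>i<9. u $ i * phi i z)"

definition mass_matrix :: "real mat" where
  "mass_matrix = mat 9 9 (\<lambda>(a, b). integral ref_square (\<lambda>z. phi a z * phi b z))"

definition represents :: "real mat \<Rightarrow> ((real \<times> real \<Rightarrow> real) \<Rightarrow> real \<times> real \<Rightarrow> real) \<Rightarrow> bool" where
  "represents A L \<longleftrightarrow>
     A \<in> carrier_mat 9 9 \<and> (\<forall>u \<in> carrier_vec 9. expand (A *\<^sub>v u) = L (expand u))"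

text \<open>There is at most one representing matrix (lemma \<open>represents_unique\<close>); for the operators
  used here one exists (\<open>represents_Dx\<close>, \<open>represents_Dy\<close>, \<open>represents_T\<close>).\<close>

definition coeff_matrix :: "((real \<times> real \<Rightarrow> real) \<Rightarrow> real \<times> real \<Rightarrow> real) \<Rightarrow> real mat" where
  "coeff_matrix L = (THE A. represents A L)"

definition partial_x :: "(real \<times> real \<Rightarrow> real) \<Rightarrow> real \<times> real \<Rightarrow> real" where
  "partial_x p = (\<lambda>(x, y). deriv (\<lambda>t. p (t, y)) x)"

definition partial_y :: "(real \<times> real \<Rightarrow> real) \<Rightarrow> real \<times> real \<Rightarrow> real" where
  "partial_y p = (\<lambda>(x, y). deriv (\<lambda>t. p (x, t)) y)"

definition rotate_plane :: "real \<Rightarrow> real \<times> real \<Rightarrow> real \<times> real" where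
  "rotate_plane \<alpha> = (\<lambda>(x, y). (cos \<alpha> * x - sin \<alpha> * y, sin \<alpha> * x + cos \<alpha> * y))"

definition Dx_matrix :: "real mat" where
  "Dx_matrix = coeff_matrix partial_x"

definition Dy_matrix :: "real mat" where
  "Dy_matrix = coeff_matrix partial_y"

definition T_matrix :: "int \<Rightarrow> real mat" where
  "T_matrix k = coeff_matrix (\<lambda>p. p \<circ> rotate_plane (of_int k * pi / 2))"

datatype face = Bottom | Right | Top | Left

text \<open>The point with face parameter \<open>s \<in> {-1..1}\<close>; this is an arc length parametrisation
  with \<open>s = x\<close>, \<open>s = y\<close>, \<open>s = -x\<close>, \<open>s = -y\<close> on the four faces.\<close>

fun face_point :: "face \<Rightarrow> real \<Rightarrow> real \<times> real" where
  "face_point Bottom s = (s, -1)"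
| "face_point Right s = (1, s)"
| "face_point Top s = (-s, 1)"
| "face_point Left s = (-1, -s)"

definition DG_correction :: "face \<Rightarrow> nat \<Rightarrow> real vec \<Rightarrow> bool" where
  "DG_correction f m u \<longleftrightarrow> u \<in> carrier_vec 9 \<and>
     (\<forall>a<9. integral ref_square (\<lambda>z. expand u z * phi a z)
          = integral {-1..1} (\<lambda>s. legendre m s * phi a (face_point f s)))"

text \<open>The coefficient vector is unique (lemma \<open>DG_correction_ex1\<close>).\<close>

definition C_DG :: "real mat" where
  "C_DG = mat 9 12 (\<lambda>(i, j).
     (THE u. DG_correction ([Bottom, Right, Top, Left] ! (j div 3)) (j mod 3) u) $ i)"

definition C_tp :: "real \<Rightarrow> real mat" where
  "C_tp c = (let \<theta> = 5 / (45 * c + 2) in mat_of_rows_list 12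
    [[ 1/2,    0,    0,  1/2,    0,    0,  1/2,    0,    0,  1/2,    0,    0],
     [   0,  1/2,    0,  3/2,    0,    0,    0, -1/2,    0, -3/2,    0,    0],
     [   0,    0,  1/2,    \<theta>,    0,    0,    0,    0,  1/2,    \<theta>,    0,    0],
     [-3/2,    0,    0,    0,  1/2,    0,  3/2,    0,    0,    0, -1/2,    0],
     [   0, -3/2,    0,    0,  3/2,    0,    0, -3/2,    0,    0,  3/2,    0],
     [   0,    0, -3/2,    0,    \<theta>,    0,    0,    0,  3/2,    0,   -\<theta>,    0],
     [   \<theta>,    0,    0,    0,    0,  1/2,    \<theta>,    0,    0,    0,    0,  1/2],
     [   0,    \<theta>,    0,    0,    0,  3/2,    0,   -\<theta>,    0,    0,    0, -3/2],
     [   0,    0,    \<theta>,    0,    0,    \<theta>,    0,    0,    \<theta>,    0,    0,    \<theta>]])"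

definition symmetric_mat :: "real mat \<Rightarrow> bool" where
  "symmetric_mat A \<longleftrightarrow> transpose_mat A = A"

definition antisymmetric_mat :: "real mat \<Rightarrow> bool" where
  "antisymmetric_mat A \<longleftrightarrow> transpose_mat A = - A"

definition positive_definite :: "nat \<Rightarrow> real mat \<Rightarrow> bool" where
  "positive_definite n A \<longleftrightarrow> A \<in> carrier_mat n n \<and> symmetric_mat A \<and>
     (\<forall>u \<in> carrier_vec n. u \<noteq> 0\<^sub>v n \<longrightarrow> u \<bullet> (A *\<^sub>v u) > 0)"

lemma legendre_1: "legendre n 1 = 1"
proof (induction n rule: less_induct)
  case (less n)
  consider "n = 0" | "n = 1" | k where "n = Suc (Suc k)"
    by (metis One_nat_def not0_implies_Suc)
  then show ?case
    by cases (use less in \<open>auto simp: field_simps\<close>)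
qed

lemma legendre_low:
  "legendre 0 = (\<lambda>x. 1)" "legendre 1 = (\<lambda>x. x)" "legendre (Suc 0) = (\<lambda>x. x)"
  "legendre 2 = (\<lambda>x. (3 * x\<^sup>2 - 1) / 2)"
  by (auto simp: fun_eq_iff numeral_2_eq_2 power2_eq_square algebra_simps)

lemma expand_explicit:
  "expand u (x, y) =
     u $ 0 + u $ 1 * x + u $ 2 * ((3 * x\<^sup>2 - 1) / 2)
     + (u $ 3 + u $ 4 * x + u $ 5 * ((3 * x\<^sup>2 - 1) / 2)) * y
     + (u $ 6 + u $ 7 * x + u $ 8 * ((3 * x\<^sup>2 - 1) / 2)) * ((3 * y\<^sup>2 - 1) / 2)"
  by (simp add: expand_def phi_def lessThan_nat_numeral lessThan_Suc legendre_low algebra_simps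
        add_divide_distrib diff_divide_distrib flip: numeral_2_eq_2 del: legendre.simps)

lemma nat_less_9: "(i::nat) < 9 \<longleftrightarrow> i \<in> {0, 1, 2, 3, 4, 5, 6, 7, 8}"
  by auto

lemma expand_inj:
  assumes "u \<in> carrier_vec 9" "v \<in> carrier_vec 9" "expand u = expand v"
  shows "u = v"
proof (rule eq_vecI)
  have e: "expand u (x, y) = expand v (x, y)" for x y
    by (simp add: assms(3))
  note e' = e[of 0 0] e[of 0 1] e[of 0 "-1"] e[of 1 0] e[of 1 1] e[of 1 "-1"]
    e[of "-1" 0] e[of "-1" 1] e[of "-1" "-1"]
  note e'' = e'[unfolded expand_explicit, simplified, folded One_nat_def]
  have "u $ 0 = v $ 0" "u $ 1 = v $ 1" "u $ 2 = v $ 2" "u $ 3 = v $ 3" "u $ 4 = v $ 4"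
    "u $ 5 = v $ 5" "u $ 6 = v $ 6" "u $ 7 = v $ 7" "u $ 8 = v $ 8"
    using e'' by argo+
  then show "u $ i = v $ i" if "i < dim_vec v" for i
    using that assms by (auto simp: nat_less_9)
qed (use assms in auto)

lemma represents_unique:
  assumes "represents A L" "represents B L"
  shows "A = B"
proof -
  have AB: "A \<in> carrier_mat 9 9" "B \<in> carrier_mat 9 9"
    using assms by (auto simp: represents_def)
  have *: "A *\<^sub>v u = B *\<^sub>v u" if "u \<in> carrier_vec 9" for u
    by (rule expand_inj) (use assms that AB in \<open>auto simp: represents_def\<close>)
  have "A $$ (i, j) = B $$ (i, j)" if "i < 9" "j < 9" for i j
    using arg_cong[OF *[of "unit_vec 9 j"], of "\<lambda>v. v $ i"] AB that by simp
  then show ?thesis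
    using AB by (auto intro!: eq_matI)
qed

lemma represents_coeff_matrix:
  assumes "represents A L"
  shows "represents (coeff_matrix L) L"
  unfolding coeff_matrix_def by (rule theI[of _ A]) (use assms represents_unique in auto)

lemma represents_comp:
  assumes "represents A K" "represents B L"
  shows "represents (A * B) (K \<circ> L)"
  using assms by (auto simp: represents_def assoc_mult_mat_vec[of _ 9 9 _ 9])

lemma mult_mat_vec_explicit:
  assumes "u \<in> carrier_vec 9" "i < 9"
  shows "(mat 9 9 (\<lambda>(i, j). g i j) *\<^sub>v u) $ i =
    g i 0 * u $ 0 + g i 1 * u $ 1 + g i 2 * u $ 2 + g i 3 * u $ 3 + g i 4 * u $ 4
    + g i 5 * u $ 5 + g i 6 * u $ 6 + g i 7 * u $ 7 + g i (8::nat) * u $ 8"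
  using assms by (simp add: scalar_prod_def eval_nat_numeral)

lemma represents_Dx: "represents Dx_matrix partial_x"
proof -
  define g :: "nat \<Rightarrow> nat \<Rightarrow> real" where
    "g i j = (if (i, j) \<in> {(0, 1), (3, 4), (6, 7)} then 1
              else if (i, j) \<in> {(1, 2), (4, 5), (7, 8)} then 3 else 0)" for i j
  have "represents (mat 9 9 (\<lambda>(i, j). g i j)) partial_x"
    unfolding represents_def partial_x_def
  proof (intro conjI ballI ext, goal_cases)
    case (2 u z)
    obtain x y where z: "z = (x, y)" by force
    have "((\<lambda>t. expand u (t, y)) has_real_derivative
        (u $ 1 + u $ 2 * (3 * x) + (u $ 4 + u $ 5 * (3 * x)) * y
         + (u $ 7 + u $ 8 * (3 * x)) * ((3 * y\<^sup>2 - 1) / 2))) (at x)"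
      unfolding expand_explicit by (auto intro!: derivative_eq_intros simp: field_simps)
    then show ?case
      using 2 by (simp add: z DERIV_imp_deriv expand_explicit mult_mat_vec_explicit
          del: index_mult_mat_vec)
        (simp add: g_def algebra_simps add_divide_distrib diff_divide_distrib)
  qed auto
  then show ?thesis
    unfolding Dx_matrix_def by (rule represents_coeff_matrix)
qed

lemma represents_Dy: "represents Dy_matrix partial_y"
proof -
  define g :: "nat \<Rightarrow> nat \<Rightarrow> real" where
    "g i j = (if (i, j) \<in> {(0, 3), (1, 4), (2, 5)} then 1
              else if (i, j) \<in> {(3, 6), (4, 7), (5, 8)} then 3 else 0)" for i j
  have "represents (mat 9 9 (\<lambda>(i, j). g i j)) partial_y"
    unfolding represents_def partial_y_def
  proof (intro conjI ballI ext, goal_cases)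
    case (2 u z)
    obtain x y where z: "z = (x, y)" by force
    have "((\<lambda>t. expand u (x, t)) has_real_derivative
        (u $ 3 + u $ 4 * x + u $ 5 * ((3 * x\<^sup>2 - 1) / 2)
         + (u $ 6 + u $ 7 * x + u $ 8 * ((3 * x\<^sup>2 - 1) / 2)) * (3 * y))) (at y)"
      unfolding expand_explicit by (auto intro!: derivative_eq_intros simp: field_simps)
    then show ?case
      using 2 by (simp add: z DERIV_imp_deriv expand_explicit mult_mat_vec_explicit
          del: index_mult_mat_vec)
        (simp add: g_def field_simps)
  qed auto
  then show ?thesis
    unfolding Dy_matrix_def by (rule represents_coeff_matrix)
qed

lemma rotate_plane_add: "rotate_plane (\<alpha> + \<beta>) = rotate_plane \<alpha> \<circ> rotate_plane \<beta>"
  by (auto simp: rotate_plane_def fun_eq_iff cos_add sin_add algebra_simps)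

lemma represents_T: "represents (T_matrix k) (\<lambda>p. p \<circ> rotate_plane (of_int k * pi / 2))"
proof -
  define L where "L k = (\<lambda>p::real \<times> real \<Rightarrow> real. p \<circ> rotate_plane (of_int k * pi / 2))"
    for k :: int
  have L_add: "L (i + j) = L j \<circ> L i" for i j
    by (simp add: L_def fun_eq_iff rotate_plane_add distrib_right add_divide_distrib)
  define g :: "nat \<Rightarrow> nat \<Rightarrow> real" where
    "g i j = (if (i, j) \<in> {(0, 0), (1, 3), (2, 6), (6, 2), (7, 5), (8, 8)} then 1
              else if (i, j) \<in> {(3, 1), (4, 4), (5, 7)} then -1 else 0)" for i j
  have up: "represents (mat 9 9 (\<lambda>(i, j). g i j)) (L 1)"
    unfolding represents_def
  proof (intro conjI ballI ext, goal_cases)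
    case (2 u z)
    obtain x y where z: "z = (x, y)" by force
    show ?case
      using 2 by (simp add: z L_def rotate_plane_def expand_explicit mult_mat_vec_explicit
          del: index_mult_mat_vec)
        (simp add: g_def field_simps)
  qed auto
  have "L (-1) = L 1 \<circ> (L 1 \<circ> L 1)"
  proof -
    have "sin (3 * pi / 2) = -1" "cos (3 * pi / 2) = 0"
      using sin_3over2_pi cos_3over2_pi by (metis times_divide_eq_left)+
    then have "rotate_plane (3 * pi / 2) = rotate_plane (- pi / 2)"
      by (simp add: rotate_plane_def)
    then have "L (-1) = L (1 + 1 + 1)"
      by (simp add: L_def)
    then show ?thesis
      by (simp only: L_add)
  qed
  then obtain B where down: "represents B (L (-1))"
    using represents_comp[OF up represents_comp[OF up up]] by metis
  have "\<exists>A. represents A (L k)"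
  proof (induction k rule: int_induct[of _ 0])
    case base
    have "L 0 = id"
      by (auto simp: L_def rotate_plane_def fun_eq_iff)
    then have "represents (1\<^sub>m 9) (L 0)"
      by (simp add: represents_def)
    then show ?case ..
  next
    case (step1 i)
    then show ?case
      using represents_comp[OF up, of _ "L i"] by (auto simp only: L_add)
  next
    case (step2 i)
    then show ?case
      using represents_comp[OF down, of _ "L i"] L_add[of i "-1"] by (auto simp only: diff_conv_add_uminus)
  qed
  then show ?thesis
    unfolding T_matrix_def L_def using represents_coeff_matrix by blast
qed

lemma integral_legendre_product:
  assumes "i < 3" "j < 3"
  shows "integral {-1..1} (\<lambda>x. legendre i x * legendre j x)
    = (if i = j then 2 / (2 * real i + 1) else 0)"
proof -
  have poly: "integral {-1..1} (\<lambda>x. a + b * x + d * x ^ 2 + e * x ^ 3 + f * x ^ 4)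
      = 2 * a + 2 * d / 3 + 2 * f / 5" for a b d e f :: real
  proof -
    have "((\<lambda>x. a + b * x + d * x ^ 2 + e * x ^ 3 + f * x ^ 4) has_integral
        (a * 1 + b * 1 ^ 2 / 2 + d * 1 ^ 3 / 3 + e * 1 ^ 4 / 4 + f * 1 ^ 5 / 5)
        - (a * (-1) + b * (-1) ^ 2 / 2 + d * (-1) ^ 3 / 3 + e * (-1) ^ 4 / 4 + f * (-1) ^ 5 / 5))
        {-1..1}"
      by (rule fundamental_theorem_of_calculus)
        (auto intro!: derivative_eq_intros simp flip: has_real_derivative_iff_has_vector_derivative)
    then show ?thesis
      by (auto simp: field_simps dest: integral_unique)
  qed
  have 1: "(\<lambda>x::real. (3 * x\<^sup>2 - 1) / 2) = (\<lambda>x. -1/2 + 0 * x + 3/2 * x ^ 2 + 0 * x ^ 3 + 0 * x ^ 4)"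
    "(\<lambda>x::real. x * ((3 * x\<^sup>2 - 1) / 2)) = (\<lambda>x. 0 + -1/2 * x + 0 * x ^ 2 + 3/2 * x ^ 3 + 0 * x ^ 4)"
    "(\<lambda>x::real. (3 * x\<^sup>2 - 1) / 2 * x) = (\<lambda>x. 0 + -1/2 * x + 0 * x ^ 2 + 3/2 * x ^ 3 + 0 * x ^ 4)"
    "(\<lambda>x::real. (3 * x\<^sup>2 - 1) / 2 * ((3 * x\<^sup>2 - 1) / 2))
      = (\<lambda>x. 1/4 + 0 * x + -3/2 * x ^ 2 + 0 * x ^ 3 + 9/4 * x ^ 4)"
    "(\<lambda>x::real. x * x) = (\<lambda>x. 0 + 0 * x + 1 * x ^ 2 + 0 * x ^ 3 + 0 * x ^ 4)"
    "(\<lambda>x::real. x) = (\<lambda>x. 0 + 1 * x + 0 * x ^ 2 + 0 * x ^ 3 + 0 * x ^ 4)"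
    "(\<lambda>x::real. 1) = (\<lambda>x. 1 + 0 * x + 0 * x ^ 2 + 0 * x ^ 3 + 0 * x ^ 4)"
    by (auto simp: fun_eq_iff field_simps eval_nat_numeral)
  note ints = 1[THEN arg_cong, of "integral {-1..1}", unfolded poly]
  have "i \<in> {0, 1, 2}" "j \<in> {0, 1, 2}"
    using assms by auto
  then show ?thesis
    using ints by (auto simp: legendre_low simp del: legendre.simps)
qed

lemma continuous_on_legendre: "continuous_on A (legendre n)"
proof (induction n rule: less_induct)
  case (less n)
  consider "n = 0" | "n = 1" | k where "n = Suc (Suc k)"
    by (metis One_nat_def not0_implies_Suc)
  then show ?case
  proof cases
    case 3
    then show ?thesis
      using less by (auto intro!: continuous_intros)
  qed auto
qed

lemma continuous_on_phi: "continuous_on A (phi i)"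
  unfolding phi_def case_prod_beta
  by (intro continuous_intros continuous_on_compose2[OF continuous_on_legendre[of UNIV]]) auto

lemma ref_square_cbox: "ref_square = cbox (-1, -1) (1, 1)"
  by (simp add: ref_square_def cbox_Pair_eq)

lemma integral_phi_product:
  assumes "a < 9" "b < 9"
  shows "integral ref_square (\<lambda>z. phi a z * phi b z) =
    (if a = b then 4 / ((2 * real (a mod 3) + 1) * (2 * real (a div 3) + 1)) else 0)"
proof -
  have eq: "a = b" if "a mod 3 = b mod 3" "a div 3 = b div 3"
    using that by (metis div_mult_mod_eq)
  have "integral ref_square (\<lambda>z. phi a z * phi b z) =
      integral {-1..1} (\<lambda>x. integral {-1..1} (\<lambda>y. phi a (x, y) * phi b (x, y)))"
    unfolding ref_square_cbox cbox_interval[symmetric]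
    by (rule integral_prod_continuous) (intro continuous_intros continuous_on_phi)
  also have "\<dots> = integral {-1..1} (\<lambda>x. legendre (a mod 3) x * legendre (b mod 3) x *
      integral {-1..1} (\<lambda>y. legendre (a div 3) y * legendre (b div 3) y))"
    by (simp add: phi_def mult_ac flip: integral_mult_right)
  also have "\<dots> = integral {-1..1} (\<lambda>x. legendre (a mod 3) x * legendre (b mod 3) x) *
      integral {-1..1} (\<lambda>y. legendre (a div 3) y * legendre (b div 3) y)"
    by simp
  also have "\<dots> = (if a = b then 4 / ((2 * real (a mod 3) + 1) * (2 * real (a div 3) + 1)) else 0)"
    using assms eq
    by (auto simp: integral_legendre_product less_mult_imp_div_less)
  finally show ?thesis .
qed

lemma integral_expand_phi:
  assumes "a < 9"
  shows "integral ref_square (\<lambda>z. expand u z * phi a z) =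
    u $ a * (4 / ((2 * real (a mod 3) + 1) * (2 * real (a div 3) + 1)))"
proof -
  have int: "(\<lambda>z. u $ i * (phi i z * phi a z)) integrable_on ref_square" for i
    unfolding ref_square_cbox
    by (intro integrable_continuous continuous_intros continuous_on_phi)
  have "integral ref_square (\<lambda>z. expand u z * phi a z) =
      integral ref_square (\<lambda>z. \<Sum>i<9. u $ i * (phi i z * phi a z))"
    by (simp add: expand_def sum_distrib_right mult.assoc)
  also have "\<dots> = (\<Sum>i<9. u $ i * integral ref_square (\<lambda>z. phi i z * phi a z))"
    using int by (subst integral_sum) auto
  also have "\<dots> = (\<Sum>i<9. if i = a then
      u $ a * (4 / ((2 * real (a mod 3) + 1) * (2 * real (a div 3) + 1))) else 0)"
    using assms by (intro sum.cong) (auto simp: integral_phi_product)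
  finally show ?thesis
    using assms by simp
qed

lemma DG_correction_ex1: "\<exists>!u. DG_correction f m u"
proof -
  define d where "d a = 4 / ((2 * real (a mod 3) + 1) * (2 * real (a div 3) + 1))" for a :: nat
  have d: "d a \<noteq> 0" for a
    unfolding d_def by (auto simp: add_eq_0_iff)
  define B where "B a = integral {-1..1} (\<lambda>s. legendre m s * phi a (face_point f s))" for a
  have int: "integral ref_square (\<lambda>z. expand u z * phi a z) = u $ a * d a" if "a < 9" for u a
    unfolding d_def using that by (rule integral_expand_phi)
  have eq: "DG_correction f m u \<longleftrightarrow> u = vec 9 (\<lambda>a. B a / d a)" for u
    using d by (auto simp: DG_correction_def int B_def[symmetric] eq_divide_eq)
  show ?thesis
    unfolding eq by simp
qed

end

theory Submission
  imports Defs
begin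

text \<open>Since \<open>C_DG = C_tp 0\<close>, the equation asks for \<open>Q * C_tp c = - M * (C_tp c - C_tp 0)\<close>.
  As \<open>\<partial>/\<partial>x\<close> annihilates the modes \<open>\<psi>\<^sub>0(x) \<psi>\<^sub>w(y)\<close> and is skew for the bilinear form of \<open>Q\<close>,
  that form vanishes on pairs of such modes, because \<open>\<psi>\<^sub>0(x) \<psi>\<^sub>w(y)\<close> is also the derivative of
  \<open>\<psi>\<^sub>1(x) \<psi>\<^sub>w(y)\<close>. The column of \<open>C_tp c\<close> for the bottom face and \<open>\<psi>\<^sub>0\<close> contains only such modes,
  so testing it with \<open>\<psi>\<^sub>2(y)\<close> gives \<open>\<theta> = 5/2\<close>, that is \<open>c = 0\<close>. Then the columns of \<open>C_DG\<close> lie in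
  the kernel of \<open>Q\<close>; they span a space of dimension 8 whose complement is spanned by the constants,
  on which the form vanishes as well.\<close>

lemma legendre_uminus: "legendre n (- x) = (- 1) ^ n * legendre n x"
proof (induction n x rule: legendre.induct)
  case (3 n x)
  then show ?case
    by (simp add: field_simps)
qed auto

text \<open>On each face one Legendre factor of \<open>phi a\<close> is constant, equal to
  \<open>1\<close> at \<open>1\<close> or \<open>(- 1) ^ n\<close> at \<open>-1\<close>. The other
  is a Legendre polynomial in \<open>s\<close>, up to a parity sign where the face parameter is
  reversed, so orthogonality applies.\<close>

lemma integral_legendre_face:
  assumes "m < 3" "a < 9"
  shows "integral {-1..1} (\<lambda>s. legendre m s * phi a (face_point f s)) =
    (case f of
      Bottom \<Rightarrow> if a mod 3 = m then (- 1) ^ (a div 3) * 2 / (2 * real m + 1) else 0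
    | Right \<Rightarrow> if a div 3 = m then 2 / (2 * real m + 1) else 0
    | Top \<Rightarrow> if a mod 3 = m then (- 1) ^ (a mod 3) * 2 / (2 * real m + 1) else 0
    | Left \<Rightarrow> if a div 3 = m then (- 1) ^ (a mod 3) * (- 1) ^ (a div 3) * 2 / (2 * real m + 1)
        else 0)"
proof -
  have int: "integral {-1..1} (\<lambda>s. legendre m s * (b * legendre n s))
      = (if n = m then b * 2 / (2 * real m + 1) else 0)" if "n < 3" for n b
    using integral_legendre_product[OF assms(1) that]
    by (simp add: mult.left_commute[of _ b])
  have lt: "a mod 3 < 3" "a div 3 < 3"
    using assms by auto
  have face: "(\<lambda>s. legendre m s * phi a (face_point f s)) = (\<lambda>s. legendre m s * (case f of
      Bottom \<Rightarrow> (- 1) ^ (a div 3) * legendre (a mod 3) s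
    | Right \<Rightarrow> 1 * legendre (a div 3) s
    | Top \<Rightarrow> (- 1) ^ (a mod 3) * legendre (a mod 3) s
    | Left \<Rightarrow> ((- 1) ^ (a mod 3) * (- 1) ^ (a div 3)) * legendre (a div 3) s))"
    by (cases f) (simp_all only: phi_def face_point.simps prod.case face.case legendre_uminus
        legendre_1 mult_1_left mult_1_right mult_ac)
  show ?thesis
    unfolding face
    by (cases f) (simp_all only: face.case int[OF lt(1)] int[OF lt(2)]
        int[OF lt(2), of 1, unfolded mult_1_left] mult_1_left)
qed

text \<open>The modes are orthogonal, so inverting the mass matrix only divides each face moment by
  a diagonal entry.\<close>

lemma C_DG_entry:
  assumes "i < 9" "j < 12"
  shows "C_DG $$ (i, j) =
    integral {-1..1} (\<lambda>s. legendre (j mod 3) s *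
      phi i (face_point ([Bottom, Right, Top, Left] ! (j div 3)) s))
    * ((2 * real (i mod 3) + 1) * (2 * real (i div 3) + 1) / 4)"
proof -
  define u where "u = (THE u. DG_correction ([Bottom, Right, Top, Left] ! (j div 3)) (j mod 3) u)"
  have "DG_correction ([Bottom, Right, Top, Left] ! (j div 3)) (j mod 3) u"
    unfolding u_def by (rule theI') (rule DG_correction_ex1)
  then have "u $ i * (4 / ((2 * real (i mod 3) + 1) * (2 * real (i div 3) + 1))) =
      integral {-1..1} (\<lambda>s. legendre (j mod 3) s *
        phi i (face_point ([Bottom, Right, Top, Left] ! (j div 3)) s))"
    using assms by (simp add: DG_correction_def integral_expand_phi)
  moreover have "2 * real (i mod 3) + 1 \<noteq> 0" "2 * real (i div 3) + 1 \<noteq> 0"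
    by (simp_all add: add_nonneg_eq_0_iff)
  moreover have "C_DG $$ (i, j) = u $ i"
    using assms by (simp add: C_DG_def u_def)
  ultimately show ?thesis
    by (simp add: divide_simps)
qed

lemma nat_less_12: "(j::nat) < 12 \<longleftrightarrow> j \<in> {0, 1, 2, 3, 4, 5, 6, 7, 8, 9, 10, 11}"
  unfolding insert_iff empty_iff by arith

lemma C_tp_carrier: "C_tp c \<in> carrier_mat 9 12"
  by (rule carrier_matI) (simp_all add: C_tp_def Let_def mat_of_rows_list_def)

text \<open>For \<open>c = 0\<close> the parameter \<theta> equals \<open>5/2\<close>, the DG value
  at every position of \<theta>; all 108 entries are compared.\<close>

lemma C_DG_eq_C_tp_0: "C_DG = C_tp 0"
proof (rule eq_matI)
  fix i j assume "i < dim_row (C_tp 0)" "j < dim_col (C_tp 0)"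
  then have ij: "i < 9" "j < 12"
    using C_tp_carrier[of 0] by auto
  have "j mod 3 < 3"
    by simp
  note entry = C_DG_entry[OF ij, unfolded integral_legendre_face[OF this ij(1)]]
  show "C_DG $$ (i, j) = C_tp 0 $$ (i, j)"
    unfolding entry using ij unfolding nat_less_9 nat_less_12 insert_iff empty_iff
    by (elim disjE FalseE; simp add: C_tp_def Let_def mat_of_rows_list_def)
qed (use C_tp_carrier[of 0] in \<open>auto simp: C_DG_def\<close>)

lemma expand_unit_vec:
  assumes "i < 9"
  shows "expand (unit_vec 9 i) = phi i"
proof
  fix z
  have "expand (unit_vec 9 i) z = (\<Sum>j<9. if j = i then phi j z else 0)"
    unfolding expand_def by (rule sum.cong) (use assms in auto)
  then show "expand (unit_vec 9 i) z = phi i z"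
    using assms by simp
qed

lemma Dx_carrier: "Dx_matrix \<in> carrier_mat 9 9"
  using represents_Dx by (simp add: represents_def)

lemma expand_Dx_unit_vec:
  assumes "i < 9"
  shows "expand (Dx_matrix *\<^sub>v unit_vec 9 i) = partial_x (phi i)"
  using represents_Dx assms by (simp add: represents_def expand_unit_vec)

lemma Dx_mode_0:
  assumes "w < 3"
  shows "Dx_matrix *\<^sub>v unit_vec 9 (3 * w) = 0\<^sub>v 9"
proof (rule expand_inj)
  have "partial_x (phi (3 * w)) = expand (0\<^sub>v 9)"
    by (auto simp: partial_x_def phi_def expand_def fun_eq_iff)
  then show "expand (Dx_matrix *\<^sub>v unit_vec 9 (3 * w)) = expand (0\<^sub>v 9)"
    using assms by (simp add: expand_Dx_unit_vec)
qed (use Dx_carrier in auto)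

lemma Dx_mode_1:
  assumes "w < 3"
  shows "Dx_matrix *\<^sub>v unit_vec 9 (3 * w + 1) = unit_vec 9 (3 * w)"
proof (rule expand_inj)
  have "deriv (\<lambda>t. t * b) x = b" for b x :: real
    by (rule DERIV_imp_deriv) (auto intro!: derivative_eq_intros)
  moreover have "(3 * w + 1) mod 3 = 1" "(3 * w + 1) div 3 = w"
    by presburger+
  ultimately have "partial_x (phi (3 * w + 1)) = phi (3 * w)"
    by (auto simp: partial_x_def phi_def fun_eq_iff)
  then show "expand (Dx_matrix *\<^sub>v unit_vec 9 (3 * w + 1)) = expand (unit_vec 9 (3 * w))"
    using assms by (simp add: expand_Dx_unit_vec expand_unit_vec)
qed (use Dx_carrier in auto)

text \<open>Mode \<open>3 * w\<close> is the derivative of mode \<open>3 * w + 1\<close>.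
  Antisymmetry swaps the indices of \<open>Q * Dx_matrix\<close>, so that the derivative falls on
  mode \<open>3 * v\<close> instead, which it kills.\<close>

lemma form_x_constant_modes:
  assumes Q: "Q \<in> carrier_mat 9 9" and skew: "antisymmetric_mat (Q * Dx_matrix)"
    and "v < 3" "w < 3"
  shows "Q $$ (3 * v, 3 * w) = 0"
proof -
  have entry: "(Q * Dx_matrix) $$ (i, j) = (Q *\<^sub>v (Dx_matrix *\<^sub>v unit_vec 9 j)) $ i"
    if "i < 9" "j < 9" for i j
  proof -
    have "Q *\<^sub>v (Dx_matrix *\<^sub>v unit_vec 9 j) = (Q * Dx_matrix) *\<^sub>v unit_vec 9 j"
      using Q Dx_carrier by (simp add: assoc_mult_mat_vec[of _ 9 9 _ 9])
    then show ?thesis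
      using that Q Dx_carrier by (simp del: assoc_mult_mat_vec)
  qed
  have "Q $$ (3 * v, 3 * w) = (Q * Dx_matrix) $$ (3 * v, 3 * w + 1)"
    using assms by (simp add: entry Dx_mode_1[simplified] del: index_mult_mat)
  also have "\<dots> = - (transpose_mat (Q * Dx_matrix)) $$ (3 * v, 3 * w + 1)"
    using assms Dx_carrier unfolding antisymmetric_mat_def by auto
  also have "\<dots> = - (Q * Dx_matrix) $$ (3 * w + 1, 3 * v)"
    using assms Dx_carrier by simp
  also have "\<dots> = 0"
    using assms by (simp add: entry Dx_mode_0 scalar_prod_def del: index_mult_mat)
  finally show ?thesis .
qed

lemma mult_mat_explicit:
  assumes "A \<in> carrier_mat 9 9" "B \<in> carrier_mat 9 n" "i < 9" "j < n"
  shows "(A * B) $$ (i, j) =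
    A $$ (i, 0) * B $$ (0, j) + A $$ (i, 1) * B $$ (1, j) + A $$ (i, 2) * B $$ (2, j)
    + A $$ (i, 3) * B $$ (3, j) + A $$ (i, 4) * B $$ (4, j) + A $$ (i, 5) * B $$ (5, j)
    + A $$ (i, 6) * B $$ (6, j) + A $$ (i, 7) * B $$ (7, j) + A $$ (i, 8) * B $$ (8, j)"
  using assms by (simp add: scalar_prod_def eval_nat_numeral)

lemma mass_matrix_carrier: "mass_matrix \<in> carrier_mat 9 9"
  by (simp add: mass_matrix_def)

theorem mainTheorem3:
  fixes c :: real and Q :: "real mat"
  assumes "c > - 2 / 45"
    and "Q \<in> carrier_mat 9 9"
    and "symmetric_mat Q"
    and "antisymmetric_mat (Q * Dx_matrix)"
    and "antisymmetric_mat (Q * Dy_matrix)"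
    and "positive_definite 9 (mass_matrix + Q)"
    and "\<forall>k::int. T_matrix k * Q = Q * T_matrix k"
  shows "Q * C_tp c = - (mass_matrix * (C_tp c - C_DG)) \<longleftrightarrow> c = 0 \<and> Q = 0\<^sub>m 9 9"
proof
  assume "c = 0 \<and> Q = 0\<^sub>m 9 9"
  then show "Q * C_tp c = - (mass_matrix * (C_tp c - C_DG))"
    using C_tp_carrier[of 0] mass_matrix_carrier
    by (auto simp: C_DG_eq_C_tp_0 minus_r_inv_mat[of _ 9 12] intro!: eq_matI)
next
  assume eq: "Q * C_tp c = - (mass_matrix * (C_tp c - C_DG))"
  define \<theta> where "\<theta> = 5 / (45 * c + 2)"
  have Q0: "Q $$ (3 * v, 3 * w) = 0" if "v < 3" "w < 3" for v w
    using form_x_constant_modes assms(2,4) that by blast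
  have diff: "C_tp c - C_tp 0 \<in> carrier_mat 9 12"
    using C_tp_carrier by (intro minus_carrier_mat)
  \<comment> \<open>Column 0 is nonzero only in rows 0, 3 and 6, the modes constant in
    \<open>x\<close>; row 6 tests with the third of them.\<close>
  have "(Q * C_tp c) $$ (6, 0) = 0"
    using Q0[of 2 0] Q0[of 2 1] Q0[of 2 2]
    by (subst mult_mat_explicit[OF assms(2) C_tp_carrier])
      (simp_all add: C_tp_def Let_def mat_of_rows_list_def)
  \<comment> \<open>The factor \<open>4 / 5\<close> is the diagonal mass entry of mode 6.\<close>
  moreover have "(mass_matrix * (C_tp c - C_tp 0)) $$ (6, 0) = 4 / 5 * (\<theta> - 5 / 2)"
    by (subst mult_mat_explicit[OF mass_matrix_carrier diff])
      (simp_all add: C_tp_def Let_def mat_of_rows_list_def mass_matrix_def integral_phi_product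
        \<theta>_def)
  ultimately have "\<theta> = 5 / 2"
    using carrier_matD[OF C_tp_carrier] carrier_matD[OF mass_matrix_carrier]
    by (simp add: eq C_DG_eq_C_tp_0 del: index_mult_mat(1))
  then have c: "c = 0"
    using assms(1) by (simp add: \<theta>_def field_simps)
  have QC: "(Q * C_tp 0) $$ (i, j) = 0" if "i < 9" "j < 12" for i j
    using that C_tp_carrier[of 0] mass_matrix_carrier eq
    by (simp add: c C_DG_eq_C_tp_0 minus_r_inv_mat[of _ 9 12])
  \<comment> \<open>A row \<open>q\<close> orthogonal to all columns of \<open>C_DG\<close> makes
    the polynomial with coefficients \<open>M^(-1) q\<close> vanish on the boundary. It is thus a
    multiple of the bubble \<open>(1 - x^2) * (1 - y^2)\<close>, proportional to the product of
    \<open>1 - legendre 2 x\<close> and \<open>1 - legendre 2 y\<close>; applying \<open>M\<close>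
    gives the ratios \<open>-1/5\<close> and \<open>1/25\<close>.\<close>
  have row: "Q $$ (i, 1) = 0" "Q $$ (i, 3) = 0" "Q $$ (i, 4) = 0" "Q $$ (i, 5) = 0"
    "Q $$ (i, 7) = 0" "Q $$ (i, 2) = - Q $$ (i, 0) / 5" "Q $$ (i, 6) = - Q $$ (i, 0) / 5"
    "Q $$ (i, 8) = Q $$ (i, 0) / 25"
    if "i < 9" for i
  proof -
    have col: "Q $$ (i, 0) * C_tp 0 $$ (0, j) + Q $$ (i, 1) * C_tp 0 $$ (1, j)
        + Q $$ (i, 2) * C_tp 0 $$ (2, j) + Q $$ (i, 3) * C_tp 0 $$ (3, j)
        + Q $$ (i, 4) * C_tp 0 $$ (4, j) + Q $$ (i, 5) * C_tp 0 $$ (5, j)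
        + Q $$ (i, 6) * C_tp 0 $$ (6, j) + Q $$ (i, 7) * C_tp 0 $$ (7, j)
        + Q $$ (i, 8) * C_tp 0 $$ (8, j) = 0" if "j < 12" for j
      using QC[OF \<open>i < 9\<close> that] mult_mat_explicit[OF assms(2) C_tp_carrier \<open>i < 9\<close> that] by simp
    note cols = col[of 0] col[of 1] col[of 2] col[of 3] col[of 4] col[of 5] col[of 6] col[of 7]
      col[of 8] col[of 9] col[of 10] col[of 11]
    note cols' = cols[unfolded C_tp_def Let_def mat_of_rows_list_def, simplified,
      folded One_nat_def]
    show "Q $$ (i, 1) = 0" "Q $$ (i, 3) = 0" "Q $$ (i, 4) = 0" "Q $$ (i, 5) = 0"
      "Q $$ (i, 7) = 0" "Q $$ (i, 2) = - Q $$ (i, 0) / 5" "Q $$ (i, 6) = - Q $$ (i, 0) / 5"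
      "Q $$ (i, 8) = Q $$ (i, 0) / 25"
      using cols' by linarith+
  qed
  have sym: "Q $$ (i, j) = Q $$ (j, i)" if "i < 9" "j < 9" for i j
    using assms(2,3) that unfolding symmetric_mat_def by (metis carrier_matD index_transpose_mat(1))
  have row_0: "Q $$ (0, j) = 0" if "j < 9" for j
    using row[of 0] Q0[of 0 0] that by (auto simp: nat_less_9)
  \<comment> \<open>Every row is determined by its entry in column 0, which by symmetry lies in the
    vanishing row 0.\<close>
  have "Q $$ (i, j) = 0" if "i < 9" "j < 9" for i j
    using row[OF that(1)] row_0[OF that(1)] sym[OF that(1), of 0] that(2)
    by (auto simp: nat_less_9)
  then show "c = 0 \<and> Q = 0\<^sub>m 9 9"
    using c assms(2) by (auto intro!: eq_matI)
qed

end
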